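(* Let $M(n)$ be an upper bound on the number of messages used by one invocation of the maximum protocol or of the minimum protocol (on at most $n$ participating nodes) inside the Top-$k$-Position Monitoring algorithm described in the context, and let $\Delta=\max_t\,(v_{(k)}^t-v_{(k+1)}^t)$, where $v_{(k)}^t$ and $v_{(k+1)}^t$ are the $k$-th and $(k+1)$-st largest values among $v_1^t,\dots,v_n^t$. Then this algorithm is $O\big((\log\Delta+k)\cdot M(n)\big)$-competitive.
   Context: Model: $n$ nodes with IDs $1,\dots,n$ and one coordinator. Node $i$ observes an online stream $v_i^1,v_i^2,\dots\in\mathbb{N}$ (it knows $v_i^t$ at time $t$ but no future values); values are pairwise distinct at every time. A node can send a message to the coordinator, the coordinator can send a message to one node or broadcast one message to all nodes; every message costs one unit. Between consecutive time steps an arbitrary communication protocol may be run. Top-$k$-Position Monitoring: at every time $t$ the coordinator must know the set (top-$k$) of IDs of the nodes holding the $k$ largest values at time $t$. Filters: a set of filters at time $t$ is an $n$-tuple of intervals $F_i=[l_i,u_i]\subseteq\mathbb{N}\cup\{-\infty,\infty\}$ with $v_i^t\in F_i$ such that, as long as each node's value stays in its interval, the top-$k$ set does not change. A filter-based algorithm lets the coordinator assign intervals that always form a set of filters; a node violates its filter when its value leaves its interval. OPT is an optimal offline filter-based algorithm (knowing all streams in advance), whose cost is its number of messages (at least its number of filter updates). An online algorithm is $c$-competitive if on every instance its (expected, if randomized) number of messages is at most $c$ times that of OPT. The algorithm assumes a MaximumProtocol (resp. MinimumProtocol) which, run by a set of nodes at a fixed time, lets the coordinator learn the maximum (resp. minimum)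 value among them and its holder. FilterReset (also run at time $0$): the coordinator applies the MaximumProtocol $k+1$ times, each time to all nodes not yet found, thereby learning the $k+1$ largest values; it sets $M$ to the midpoint between the $k$-th and $(k+1)$-st largest values and broadcasts $M$; the current top-$k$ nodes set their filters to $[M,\infty]$ and all other nodes to $[-\infty,M]$; the time $t_0$ of this reset starts a new phase, with $T^+$ initialised to the $k$-th and $T^-$ to the $(k+1)$-st largest value. At each time $t>0$: violating nodes that were in top-$k$ at time $t-1$ run the MinimumProtocol among themselves, violating nodes not in top-$k$ at $t-1$ run the MaximumProtocol among themselves. If any value was communicated, the coordinator runs the FilterViolationHandler: let $min$ be the minimum so obtained (if any) and $max$ the maximum so obtained (if any); if $max$ is not set, it computes $max$ by running the MaximumProtocol on all nodes not in top-$k$ at $t-1$; otherwise it computes $min$ by running the MinimumProtocol on all nodes in top-$k$ at $t-1$. It updates $T^+\leftarrow\min(T^+,min)$ and $T^-\leftarrow\max(T^-,max)$. If $T^+<T^-$ it calls FilterReset; otherwise it broadcasts the midpoint $M$ of $[T^-,T^+]$ and nodes update their filters to $[M,\infty]$ (top-$k$ nodes) or $[-\infty,M]$ (others). *)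

theory Defs
  imports "HOL-Probability.Probability"
begin

section \<open>Streams and top-k sets\<close>

text \<open>Nodes are \<open>{1..n}\<close> and \<open>v t i\<close> is the value of node \<open>i\<close> at time \<open>t\<close>;
  a single vector of values is usually called \<open>w\<close>.\<close>

type_synonym streams = "nat \<Rightarrow> nat \<Rightarrow> nat"

definition distinct_streams :: "nat \<Rightarrow> streams \<Rightarrow> bool" where
  "distinct_streams n v \<longleftrightarrow> (\<forall>t. inj_on (v t) {1..n})"

definition topk :: "nat \<Rightarrow> nat \<Rightarrow> (nat \<Rightarrow> nat) \<Rightarrow> nat set" where
  "topk n k w = {i \<in> {1..n}. card {j \<in> {1..n}. w i < w j} < k}"

definition kth_largest :: "nat \<Rightarrow> nat \<Rightarrow> (nat \<Rightarrow> nat) \<Rightarrow> nat" where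
  "kth_largest n k w = rev (sort (map w [1..<Suc n])) ! (k - 1)"

definition Delta :: "nat \<Rightarrow> nat \<Rightarrow> streams \<Rightarrow> nat \<Rightarrow> nat" where
  "Delta n k v T = Max ((\<lambda>t. kth_largest n k (v t) - kth_largest n (k + 1) (v t)) ` {..T})"


section \<open>Filters and the optimal offline algorithm\<close>

text \<open>The pair \<open>(l, u)\<close> stands for the interval from \<open>l\<close> to \<open>u\<close>. Only its natural members
  matter, so admitting arbitrary extended real endpoints yields the same filters as
  endpoints in the naturals or infinite ones, and a midpoint need not be rounded.\<close>

type_synonym filt = "ereal \<times> ereal"

definition in_filter :: "nat \<Rightarrow> filt \<Rightarrow> bool" where
  "in_filter x f \<longleftrightarrow> fst f \<le> ereal (real x) \<and> ereal (real x) \<le> snd f"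

definition is_filter_set :: "nat \<Rightarrow> nat \<Rightarrow> (nat \<Rightarrow> nat) \<Rightarrow> (nat \<Rightarrow> filt) \<Rightarrow> bool" where
  "is_filter_set n k w F \<longleftrightarrow>
     (\<forall>i\<in>{1..n}. in_filter (w i) (F i)) \<and>
     (\<forall>w'. inj_on w' {1..n} \<longrightarrow> (\<forall>i\<in>{1..n}. in_filter (w' i) (F i)) \<longrightarrow>
        topk n k w' = topk n k w)"

datatype message = Report nat | Unicast nat | Broadcast

definition reaches :: "message list \<Rightarrow> nat \<Rightarrow> bool" where
  "reaches ms i \<longleftrightarrow> Unicast i \<in> set ms \<or> Broadcast \<in> set ms"

text \<open>An offline filter-based algorithm on the times \<open>0, \<dots>, T\<close> is given by its filters \<open>F t i\<close>
  and the messages \<open>ms t\<close> sent at time \<open>t\<close> (contents are unrestricted, so one broadcast may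
  update all filters). A node changes its filter only if a message reaches it, and
  nodes hold no filter before time \<open>0\<close>, so the initial assignment has to be sent as well.\<close>

definition offline_filter_alg ::
  "nat \<Rightarrow> nat \<Rightarrow> streams \<Rightarrow> nat \<Rightarrow> (nat \<Rightarrow> nat \<Rightarrow> filt) \<Rightarrow> (nat \<Rightarrow> message list) \<Rightarrow> bool" where
  "offline_filter_alg n k v T F ms \<longleftrightarrow>
     (\<forall>t\<le>T. is_filter_set n k (v t) (F t) \<and>
        (\<forall>i\<in>{1..n}. t = 0 \<or> F t i \<noteq> F (t - 1) i \<longrightarrow> reaches (ms t) i))"

text \<open>The infimum is attained: assigning the filters \<open>(v t i, v t i)\<close> and broadcasting at
  every time is admissible, so the set is not empty.\<close>

definition OPT :: "nat \<Rightarrow> nat \<Rightarrow> streams \<Rightarrow> nat \<Rightarrow> nat" where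
  "OPT n k v T = Inf {\<Sum>t\<le>T. length (ms t) | F ms. offline_filter_alg n k v T F ms}"

text \<open>\<open>cost v T\<close> is the (expected) number of messages sent at the times \<open>0, \<dots>, T\<close> on
  the streams \<open>v\<close>; the ratio may depend on the instance, as \<open>\<Delta>\<close> does.\<close>

definition competitive ::
  "nat \<Rightarrow> nat \<Rightarrow> (streams \<Rightarrow> nat \<Rightarrow> real) \<Rightarrow> (streams \<Rightarrow> nat \<Rightarrow> real) \<Rightarrow> bool" where
  "competitive n k cost c \<longleftrightarrow>
     (\<forall>v T. distinct_streams n v \<longrightarrow> cost v T \<le> c v T * real (OPT n k v T))"


section \<open>The monitoring algorithm\<close>

datatype protocol = MaximumProtocol | MinimumProtocol

text \<open>A call is a protocol together with its set of participating nodes.\<close>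

type_synonym call = "protocol \<times> nat set"

record state =
  filters :: "nat \<Rightarrow> filt"
  tops :: "nat set"
  Tplus :: nat
  Tminus :: nat

text \<open>Resulting state, protocol calls made (in order), and number of further messages.\<close>

type_synonym outcome = "state \<times> call list \<times> nat"

definition midpoint_filters :: "nat set \<Rightarrow> nat \<Rightarrow> nat \<Rightarrow> nat \<Rightarrow> filt" where
  "midpoint_filters A a b i =
     (let M = ereal ((real a + real b) / 2) in if i \<in> A then (M, \<infinity>) else (-\<infinity>, M))"

text \<open>The nodes not yet found after \<open>j\<close> runs of the maximum protocol.\<close>

primrec remaining :: "nat \<Rightarrow> (nat \<Rightarrow> nat) \<Rightarrow> nat \<Rightarrow> nat set" where
  "remaining n w 0 = {1..n}"
| "remaining n w (Suc j) = {i \<in> remaining n w j. w i \<noteq> Max (w ` remaining n w j)}"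

definition filter_reset :: "nat \<Rightarrow> nat \<Rightarrow> (nat \<Rightarrow> nat) \<Rightarrow> outcome" where
  "filter_reset n k w =
     (let a = Max (w ` remaining n w (k - 1));
          b = Max (w ` remaining n w k);
          A = {1..n} - remaining n w k
      in (\<lparr>filters = midpoint_filters A a b, tops = A, Tplus = a, Tminus = b\<rparr>,
          map (\<lambda>j. (MaximumProtocol, remaining n w j)) [0..<k + 1],
          1))"

definition violating :: "(nat \<Rightarrow> nat) \<Rightarrow> state \<Rightarrow> nat set \<Rightarrow> nat set" where
  "violating w s A = {i \<in> A. \<not> in_filter (w i) (filters s i)}"

definition violation_handler ::
  "nat \<Rightarrow> nat \<Rightarrow> (nat \<Rightarrow> nat) \<Rightarrow> state \<Rightarrow> nat option \<Rightarrow> nat option \<Rightarrow> outcome" where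
  "violation_handler n k w s mn mx =
     (let rest = {1..n} - tops s;
          (mn', mx', c) =
            (case mx of
               None \<Rightarrow> (the mn, Max (w ` rest), (MaximumProtocol, rest))
             | Some x \<Rightarrow> (Min (w ` tops s), x, (MinimumProtocol, tops s)));
          a = min (Tplus s) mn';
          b = max (Tminus s) mx'
      in if a < b
         then (let (s', cs, m) = filter_reset n k w in (s', c # cs, m))
         else (s\<lparr>filters := midpoint_filters (tops s) a b, Tplus := a, Tminus := b\<rparr>, [c], 1))"

text \<open>At a time \<open>t > 0\<close>, the component \<open>tops s\<close> of the previous state is the
  top-k set at time \<open>t - 1\<close>; see \<open>top_run\<close> below.\<close>

definition step :: "nat \<Rightarrow> nat \<Rightarrow> (nat \<Rightarrow> nat) \<Rightarrow> state \<Rightarrow> outcome" where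
  "step n k w s =
     (let A = violating w s (tops s);
          B = violating w s ({1..n} - tops s);
          mn = (if A = {} then None else Some (Min (w ` A)));
          mx = (if B = {} then None else Some (Max (w ` B)));
          cs = (if A = {} then [] else [(MinimumProtocol, A)]) @
               (if B = {} then [] else [(MaximumProtocol, B)])
      in if mn = None \<and> mx = None then (s, [], 0)
         else (let (s', cs', m) = violation_handler n k w s mn mx in (s', cs @ cs', m)))"

primrec run :: "nat \<Rightarrow> nat \<Rightarrow> streams \<Rightarrow> nat \<Rightarrow> outcome" where
  "run n k v 0 = filter_reset n k (v 0)"
| "run n k v (Suc t) = step n k (v (Suc t)) (fst (run n k v t))"

text \<open>\<open>X (t, j, c)\<close> is the number of messages used by the \<open>j\<close>-th protocol call \<open>c\<close>
  made at time \<open>t\<close>.\<close>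

type_synonym usage = "nat \<times> nat \<times> call \<Rightarrow> nat"

definition messages :: "nat \<Rightarrow> nat \<Rightarrow> streams \<Rightarrow> nat \<Rightarrow> usage \<Rightarrow> nat" where
  "messages n k v T X =
     (\<Sum>t\<le>T. case run n k v t of (s, cs, m) \<Rightarrow> (\<Sum>j<length cs. X (t, j, cs ! j)) + m)"

text \<open>The protocols may be randomized: \<open>P\<close> is the joint law of the numbers of messages used by
  the calls. A deterministic protocol, or a bound that holds surely, is the special case
  where the expectations below are bounded pointwise. No independence is needed.
  Since a protocol that reveals a value sends at least one message, \<open>B \<ge> 1\<close> is assumed
  where this is used; the broadcasts of the algorithm are counted separately.\<close>

definition protocol_bound :: "nat \<Rightarrow> usage measure \<Rightarrow> real \<Rightarrow> bool" where
  "protocol_bound n P B \<longleftrightarrow> prob_space P \<and>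
     (\<forall>t j p S. S \<noteq> {} \<and> S \<subseteq> {1..n} \<longrightarrow>
        integrable P (\<lambda>X. real (X (t, j, p, S))) \<and>
        (\<integral>X. real (X (t, j, p, S)) \<partial>P) \<le> B)"

definition expected_messages ::
  "nat \<Rightarrow> nat \<Rightarrow> (streams \<Rightarrow> usage measure) \<Rightarrow> streams \<Rightarrow> nat \<Rightarrow> real" where
  "expected_messages n k P v T = (\<integral>X. real (messages n k v T X) \<partial>P v)"


section \<open>The algorithm knows the top-k set\<close>

lemma topk_eqI:
  assumes "A \<subseteq> {1..n}" "card A = k" "\<And>i j. i \<in> A \<Longrightarrow> j \<in> {1..n} - A \<Longrightarrow> w j < w i"
  shows "topk n k w = A"
proof (intro equalityI subsetI)
  have fin: "finite A" using assms(1) finite_subset by blast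
  fix i assume i: "i \<in> topk n k w"
  show "i \<in> A"
  proof (rule ccontr)
    assume "i \<notin> A"
    moreover have "i \<in> {1..n}" using i unfolding topk_def by simp
    ultimately have "A \<subseteq> {j \<in> {1..n}. w i < w j}" using assms(1) assms(3)[of _ i] by blast
    then have "card A \<le> card {j \<in> {1..n}. w i < w j}" by (intro card_mono) simp_all
    then show False using i assms(2) unfolding topk_def by simp
  qed
next
  have fin: "finite A" using assms(1) finite_subset by blast
  fix i assume i: "i \<in> A"
  have "{j \<in> {1..n}. w i < w j} \<subseteq> A - {i}"
  proof
    fix j assume j: "j \<in> {j \<in> {1..n}. w i < w j}"
    show "j \<in> A - {i}" using assms(3)[OF i, of j] j by (cases "j \<in> A") auto
  qed
  then have "card {j \<in> {1..n}. w i < w j} \<le> card (A - {i})" by (intro card_mono) (simp add: fin)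
  also have "\<dots> < k" using card_Diff1_less[OF fin i] assms(2) by simp
  finally show "i \<in> topk n k w" using i assms(1) unfolding topk_def by blast
qed

lemma remaining_props:
  assumes "inj_on w {1..n}" "j \<le> n"
  shows "remaining n w j \<subseteq> {1..n}" "card (remaining n w j) = n - j"
    "\<And>x y. x \<in> remaining n w j \<Longrightarrow> y \<in> {1..n} - remaining n w j \<Longrightarrow> w x < w y"
proof -
  have "remaining n w j \<subseteq> {1..n} \<and> card (remaining n w j) = n - j \<and>
    (\<forall>x\<in>remaining n w j. \<forall>y\<in>{1..n} - remaining n w j. w x < w y)"
    using assms(2)
  proof (induction j)
    case 0
    show ?case by simp
  next
    case (Suc j)
    define R where "R = remaining n w j"
    have R: "R \<subseteq> {1..n}" "card R = n - j" "\<forall>x\<in>R. \<forall>y\<in>{1..n} - R. w x < w y"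
      using Suc.IH Suc.prems unfolding R_def by simp_all
    have fin: "finite R" using R(1) finite_subset by blast
    have "R \<noteq> {}" using R(2) Suc.prems by auto
    then have "Max (w ` R) \<in> w ` R" using fin by (intro Max_in) simp_all
    then obtain m where m: "m \<in> R" "w m = Max (w ` R)" by fastforce
    have eq: "remaining n w (Suc j) = R - {m}"
    proof -
      have "i = m" if "i \<in> R" "w i = w m" for i
        using inj_onD[OF assms(1) that(2)] that(1) R(1) m(1) by blast
      then show ?thesis unfolding remaining.simps R_def[symmetric] m(2)[symmetric] using m(1) by blast
    qed
    have lt: "w x < w m" if "x \<in> R - {m}" for x
    proof -
      have "w x \<le> w m" using that m fin by simp
      moreover have "w x \<noteq> w m" using inj_onD[OF assms(1), of x m] that R(1) m(1) by blast
      ultimately show ?thesis by simp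
    qed
    have "card (R - {m}) = n - Suc j" using card_Diff_singleton[OF m(1)] R(2) by simp
    moreover have "w x < w y" if x: "x \<in> R - {m}" and y: "y \<in> {1..n} - (R - {m})" for x y
      using lt[OF x] R(3) x y by (cases "y = m") auto
    ultimately show ?case unfolding eq using R(1) by blast
  qed
  then show "remaining n w j \<subseteq> {1..n}" "card (remaining n w j) = n - j"
    "\<And>x y. x \<in> remaining n w j \<Longrightarrow> y \<in> {1..n} - remaining n w j \<Longrightarrow> w x < w y"
    by blast+
qed

definition state_ok :: "nat \<Rightarrow> nat \<Rightarrow> (nat \<Rightarrow> nat) \<Rightarrow> state \<Rightarrow> bool" where
  "state_ok n k w s \<longleftrightarrow> tops s = topk n k w \<and> tops s \<subseteq> {1..n} \<and> card (tops s) = k \<and>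
     filters s = midpoint_filters (tops s) (Tplus s) (Tminus s) \<and>
     (\<forall>i\<in>{1..n}. in_filter (w i) (filters s i))"

lemma in_midpoint_filters:
  "in_filter x (midpoint_filters A a b i) \<longleftrightarrow>
     (if i \<in> A then a + b \<le> 2 * x else 2 * x \<le> a + b)"
  by (auto simp: in_filter_def midpoint_filters_def Let_def field_simps)

lemma state_ok_filter_reset:
  assumes "inj_on w {1..n}" "1 \<le> k" "k < n"
  shows "state_ok n k w (fst (filter_reset n k w))"
proof -
  define R where "R = remaining n w k"
  define Q where "Q = remaining n w (k - 1)"
  note Rp = remaining_props[OF assms(1), of k, folded R_def]
  note Qp = remaining_props[OF assms(1), of "k - 1", folded Q_def]
  have R: "R \<subseteq> {1..n}" "card R = n - k" using Rp assms by auto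
  have Q: "Q \<subseteq> {1..n}" "card Q = n - (k - 1)" using Qp assms by auto
  have fR: "finite R" and fQ: "finite Q" using R Q finite_subset by blast+
  have neR: "R \<noteq> {}" and neQ: "Q \<noteq> {}" using R Q assms by auto
  have RQ: "R = {i \<in> Q. w i \<noteq> Max (w ` Q)}"
    unfolding R_def Q_def using remaining.simps(2)[of n w "k - 1"] assms(2) by simp
  have c: "card ({1..n} - R) = k" using R assms card_Diff_subset[OF fR R(1)] by simp
  have t: "topk n k w = {1..n} - R"
    by (rule topk_eqI) (use Rp assms c in auto)
  have le: "Max (w ` R) \<le> Max (w ` Q)" by (rule Max_mono) (use RQ neR fQ in auto)
  have lo: "w i \<le> Max (w ` R)" if "i \<in> R" for i using that fR by simp
  have hi: "Max (w ` Q) \<le> w i" if i: "i \<in> {1..n} - R" for i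
  proof (cases "i \<in> Q")
    case True
    then show ?thesis using i RQ by auto
  next
    case False
    then have "w x \<le> w i" if "x \<in> Q" for x using Qp(3)[OF _ that, of i] i assms by fastforce
    then show ?thesis using fQ neQ by auto
  qed
  have "in_filter (w i) (midpoint_filters ({1..n} - R) (Max (w ` Q)) (Max (w ` R)) i)"
    if "i \<in> {1..n}" for i
    using lo[of i] hi[of i] le that unfolding in_midpoint_filters by (cases "i \<in> R") auto
  then show ?thesis
    unfolding state_ok_def filter_reset_def Let_def R_def[symmetric] Q_def[symmetric]
    using t c by auto
qed

lemma state_ok_step:
  assumes "inj_on w {1..n}" "1 \<le> k" "k < n" and ok: "state_ok n k w0 s"
  shows "state_ok n k w (fst (step n k w s))"
proof -
  define A where "A = violating w s (tops s)"
  define B where "B = violating w s ({1..n} - tops s)"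
  define rest where "rest = {1..n} - tops s"
  have top: "tops s \<subseteq> {1..n}" "card (tops s) = k"
    and fil: "filters s = midpoint_filters (tops s) (Tplus s) (Tminus s)"
    using ok unfolding state_ok_def by auto
  have ft: "finite (tops s)" using top finite_subset by blast
  have fr: "finite rest" unfolding rest_def by auto
  have tne: "tops s \<noteq> {}" using top assms by auto
  have "card rest = n - k" unfolding rest_def using card_Diff_subset[OF ft top(1)] top by simp
  then have rne: "rest \<noteq> {}" using assms by auto
  have Asub: "A \<subseteq> tops s" and Bsub: "B \<subseteq> rest" unfolding A_def B_def rest_def violating_def by auto
  have fA: "finite A" and fB: "finite B" using Asub Bsub ft fr finite_subset by blast+
  have A: "A = {i \<in> tops s. 2 * w i < Tplus s + Tminus s}"
    unfolding A_def violating_def fil in_midpoint_filters by auto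
  have B: "B = {i \<in> rest. Tplus s + Tminus s < 2 * w i}"
    unfolding B_def rest_def violating_def fil in_midpoint_filters by auto
  have good: "state_ok n k w s'"
    if "tops s' = tops s" "filters s' = midpoint_filters (tops s) (Tplus s') (Tminus s')"
      and b: "\<And>i. i \<in> tops s \<Longrightarrow> Tplus s' + Tminus s' \<le> 2 * w i"
        "\<And>i. i \<in> rest \<Longrightarrow> 2 * w i \<le> Tplus s' + Tminus s'" for s'
  proof -
    have lt: "w j < w i" if "i \<in> tops s" "j \<in> {1..n} - tops s" for i j
    proof -
      have "w j \<le> w i" using b(1)[of i] b(2)[of j] that unfolding rest_def by linarith
      moreover have "w j \<noteq> w i" using that assms(1) top(1) by (metis DiffE inj_onD subsetD)
      ultimately show ?thesis by simp
    qed
    have "topk n k w = tops s" by (rule topk_eqI[OF top lt])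
    then show ?thesis unfolding state_ok_def
      using that(1,2) b top by (auto simp: in_midpoint_filters rest_def)
  qed
  show ?thesis
  proof (cases "A = {} \<and> B = {}")
    case True
    have "state_ok n k w s" by (rule good) (use True A B fil in \<open>auto simp: not_less\<close>)
    then show ?thesis using True
      unfolding step_def Let_def A_def[symmetric] B_def[symmetric] by simp
  next
    case False
    define mn where "mn = (if A = {} then None else Some (Min (w ` A)))"
    define mx where "mx = (if B = {} then None else Some (Max (w ` B)))"
    define mn' where "mn' = (if B = {} then Min (w ` A) else Min (w ` tops s))"
    define mx' where "mx' = (if B = {} then Max (w ` rest) else Max (w ` B))"
    define a where "a = min (Tplus s) mn'"
    define b where "b = max (Tminus s) mx'"
    have mnle: "mn' \<le> w i" if i: "i \<in> tops s" for i
    proof (cases "B = {}")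
      case True
      with False have ne: "A \<noteq> {}" by simp
      show ?thesis
      proof (cases "i \<in> A")
        case True
        then show ?thesis using \<open>B = {}\<close> fA unfolding mn'_def by simp
      next
        case nA: False
        obtain x where x: "x \<in> A" using ne by blast
        then have "Min (w ` A) \<le> w x" using fA by simp
        also have "w x \<le> w i" using x nA i unfolding A by auto
        finally show ?thesis using True unfolding mn'_def by simp
      qed
    qed (use i ft in \<open>auto simp: mn'_def\<close>)
    have mxge: "w i \<le> mx'" if i: "i \<in> rest" for i
    proof (cases "B = {}")
      case False
      show ?thesis
      proof (cases "i \<in> B")
        case True
        then show ?thesis using \<open>B \<noteq> {}\<close> fB unfolding mx'_def by simp
      next
        case nB: False
        obtain x where x: "x \<in> B" using False by blast
        have "w i \<le> w x" using x nB i unfolding B by auto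
        also have "w x \<le> Max (w ` B)" using fB x by simp
        finally show ?thesis using False unfolding mx'_def by simp
      qed
    qed (use i fr in \<open>auto simp: mx'_def\<close>)
    have st: "fst (step n k w s) = fst (violation_handler n k w s mn mx)"
      using False
      unfolding step_def Let_def A_def[symmetric] B_def[symmetric] mn_def mx_def
      by (simp add: case_prod_beta)
    have vh: "fst (violation_handler n k w s mn mx) =
      (if a < b then fst (filter_reset n k w)
       else s\<lparr>filters := midpoint_filters (tops s) a b, Tplus := a, Tminus := b\<rparr>)"
    proof (cases "B = {}")
      case True
      then have "mn = Some mn'" "mx = None"
        using False unfolding mn_def mx_def mn'_def by simp_all
      moreover have "mx' = Max (w ` ({1..n} - tops s))"
        unfolding mx'_def rest_def using True by simp
      ultimately show ?thesis
        unfolding violation_handler_def a_def b_def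
        by (simp add: Let_def split: prod.split)
    next
      case False
      then have "mx = Some mx'" "mn' = Min (w ` tops s)"
        unfolding mx_def mx'_def mn'_def by simp_all
      then show ?thesis
        unfolding violation_handler_def a_def b_def
        by (simp add: Let_def split: prod.split)
    qed
    show ?thesis
    proof (cases "a < b")
      case True
      then show ?thesis using st vh state_ok_filter_reset[OF assms(1-3)] by simp
    next
      case False
      have "state_ok n k w (s\<lparr>filters := midpoint_filters (tops s) a b, Tplus := a, Tminus := b\<rparr>)"
      proof (rule good)
        fix i assume "i \<in> tops s"
        then have "a \<le> w i" using mnle[of i] unfolding a_def by linarith
        then show "Tplus (s\<lparr>filters := midpoint_filters (tops s) a b, Tplus := a, Tminus := b\<rparr>)
          + Tminus (s\<lparr>filters := midpoint_filters (tops s) a b, Tplus := a, Tminus := b\<rparr>) \<le> 2 * w i"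
          using False by simp
      next
        fix i assume "i \<in> rest"
        then have "w i \<le> b" using mxge[of i] unfolding b_def by linarith
        then show "2 * w i \<le> Tplus (s\<lparr>filters := midpoint_filters (tops s) a b, Tplus := a, Tminus := b\<rparr>)
          + Tminus (s\<lparr>filters := midpoint_filters (tops s) a b, Tplus := a, Tminus := b\<rparr>)"
          using False by simp
      qed simp_all
      then show ?thesis using False st vh by simp
    qed
  qed
qed

lemma top_run:
  assumes "distinct_streams n v" "1 \<le> k" "k < n"
  shows "tops (fst (run n k v t)) = topk n k (v t)"
proof -
  have "state_ok n k (v t) (fst (run n k v t))"
  proof (induction t)
    case 0
    then show ?case using assms state_ok_filter_reset unfolding distinct_streams_def by simp
  next
    case (Suc t)
    then show ?case using assms state_ok_step unfolding distinct_streams_def by simp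
  qed
  then show ?thesis unfolding state_ok_def by simp
qed

end

theory Submission
  imports Defs
begin

text \<open>A phase is the time between two consecutive filter resets. Every violation inside a phase
  moves \<open>T\<^sup>+\<close> or \<open>T\<^sup>-\<close> past the midpoint, so the gap \<open>T\<^sup>+ - T\<^sup>-\<close>, initially at most
  \<open>\<Delta>\<close>, is halved, and a phase has at most \<open>1 + log \<Delta>\<close> violations before the gap becomes negative.
  When it does, some top node has had a smaller value (at some time of the phase) than some other
  node has had (possibly at another time of the phase). No filters that are fixed throughout the
  phase can allow this, so OPT sends a message after the start of the phase.\<close>

section \<open>Order statistics\<close>

lemma topk_less:
  assumes "i \<in> topk n k w" "j \<in> {1..n} - topk n k w"
  shows "w j < w i"
proof (rule ccontr)
  assume "\<not> w j < w i"
  then have "card {x \<in> {1..n}. w j < w x} \<le> card {x \<in> {1..n}. w i < w x}"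
    by (intro card_mono) auto
  then show False using assms unfolding topk_def by auto
qed

lemma topk_cong:
  assumes "\<And>i. i \<in> {1..n} \<Longrightarrow> w i = w' i"
  shows "topk n k w = topk n k w'"
proof -
  have "{j \<in> {1..n}. w i < w j} = {j \<in> {1..n}. w' i < w' j}" if "i \<in> {1..n}" for i
    using assms that by auto
  then show ?thesis unfolding topk_def by (metis (no_types, lifting))
qed

lemma remaining_nonempty:
  assumes "inj_on w {1..n}" "j < n"
  shows "remaining n w j \<noteq> {}" "remaining n w j \<subseteq> {1..n}"
  using remaining_props(1,2)[OF assms(1), of j] assms(2) by auto

text \<open>Each run of the maximum protocol strips the first entry off the values listed in
  decreasing order. This links the maxima found by a reset to \<open>kth_largest\<close>, and hence
  to \<open>Delta\<close>.\<close>

lemma Max_remaining: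
  assumes "inj_on w {1..n}" "j < n"
  shows "Max (w ` remaining n w j) = kth_largest n (Suc j) w"
proof -
  define L where "L = rev (sort (map w [1..<Suc n]))"
  have len: "length L = n" unfolding L_def by simp
  have dis: "distinct L" using assms(1) unfolding L_def
    by (simp add: distinct_map atLeastLessThanSuc_atLeastAtMost del: upt_Suc)
  have sorted: "sorted (rev L)" unfolding L_def by simp
  have Max_drop: "Max (set (drop j L)) = L ! j" if "j < n" for j
  proof (rule Max_eqI)
    show "L ! j \<in> set (drop j L)" using that len by (metis Cons_nth_drop_Suc list.set_intros(1))
    fix y assume "y \<in> set (drop j L)"
    then obtain i where "i < n - j" "y = L ! (j + i)" using len that
      by (auto simp: in_set_conv_nth)
    then show "y \<le> L ! j" using sorted_rev_nth_mono[OF sorted, of j "j + i"] len by simp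
  qed simp
  \<comment> \<open>Since \<open>L\<close> is distinct, deleting the value \<open>L ! j\<close>
    deletes exactly one list entry.\<close>
  have "w ` remaining n w j = set (drop j L)" if "j \<le> n" for j
    using that
  proof (induction j)
    case 0
    show ?case unfolding L_def by (simp add: atLeastLessThanSuc_atLeastAtMost del: upt_Suc)
  next
    case (Suc j)
    then have IH: "w ` remaining n w j = set (drop j L)" and j: "j < n" by auto
    have "w ` remaining n w (Suc j) = set (drop j L) - {L ! j}"
      unfolding remaining.simps IH Max_drop[OF j] using IH by auto
    moreover have d: "drop j L = L ! j # drop (Suc j) L" using j len
      by (simp add: Cons_nth_drop_Suc)
    moreover have "L ! j \<notin> set (drop (Suc j) L)"
      using distinct_drop[OF dis, of j] unfolding d by simp
    ultimately show ?case by auto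
  qed
  then show ?thesis using Max_drop assms(2) unfolding kth_largest_def L_def by simp
qed

lemma Delta_upper:
  assumes "t \<le> T"
  shows "kth_largest n k (v t) - kth_largest n (k + 1) (v t) \<le> Delta n k v T"
  unfolding Delta_def using assms by (intro Max_ge) auto

text \<open>These are the facts about a fresh phase that start the invariant: the gap is positive
  and controlled by \<open>Delta\<close>, and both of its ends are values actually held by a top
  node and by a non-top node.\<close>

lemma filter_reset_props:
  assumes "inj_on w {1..n}" "1 \<le> k" "k < n"
  defines "s \<equiv> fst (filter_reset n k w)"
  shows "Tminus s < Tplus s"
    "Tplus s - Tminus s = kth_largest n k w - kth_largest n (k + 1) w"
    "Tplus s \<in> w ` tops s" "Tminus s \<in> w ` ({1..n} - tops s)"
proof -
  let ?Q = "remaining n w (k - 1)" and ?R = "remaining n w k"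
  have R: "?R = {i \<in> ?Q. w i \<noteq> Max (w ` ?Q)}"
    using remaining.simps(2)[of n w "k - 1"] assms(2) by simp
  note Rn = remaining_nonempty[OF assms(1,3)]
  have Qn: "?Q \<noteq> {}" "?Q \<subseteq> {1..n}" using remaining_nonempty[OF assms(1), of "k - 1"] assms(3) by auto
  have fin: "finite ?Q" "finite ?R" using Qn Rn finite_subset by blast+
  have s: "tops s = {1..n} - ?R" "Tplus s = Max (w ` ?Q)" "Tminus s = Max (w ` ?R)"
    unfolding s_def filter_reset_def by (simp_all add: Let_def)
  show "Tplus s - Tminus s = kth_largest n k w - kth_largest n (k + 1) w"
    unfolding s using Max_remaining[OF assms(1), of k] Max_remaining[OF assms(1), of "k - 1"] assms(2,3)
    by simp
  have MQ: "Max (w ` ?Q) \<in> w ` ?Q" using Qn fin by (intro Max_in) auto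
  have MR: "Max (w ` ?R) \<in> w ` ?R" using Rn fin by (intro Max_in) auto
  \<comment> \<open>Passing from \<open>?Q\<close> to \<open>?R\<close> removes the holder of the
    maximum of \<open>?Q\<close>, which therefore lies in \<open>tops s\<close>.\<close>
  show "Tplus s \<in> w ` tops s" using MQ Qn(2) unfolding s R by force
  show "Tminus s \<in> w ` ({1..n} - tops s)" using MR Rn(2) unfolding s by auto
  obtain x where x: "x \<in> ?R" "w x = Max (w ` ?R)" using MR by auto
  then have xQ: "x \<in> ?Q" "w x \<noteq> Max (w ` ?Q)" using R by blast+
  have "w x \<le> Max (w ` ?Q)" using xQ(1) fin by simp
  then show "Tminus s < Tplus s" using x xQ(2) unfolding s by simp
qed

section \<open>Single steps of the algorithm\<close>

text \<open>This is the side condition under which \<open>protocol_bound\<close> limits the expected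
  cost of a call.\<close>

definition valid_calls :: "nat \<Rightarrow> call list \<Rightarrow> bool" where
  "valid_calls n cs \<longleftrightarrow> (\<forall>(p, S) \<in> set cs. S \<noteq> {} \<and> S \<subseteq> {1..n})"

lemma filter_reset_calls:
  assumes "inj_on w {1..n}" "k < n"
  shows "\<exists>s cs. filter_reset n k w = (s, cs, 1) \<and> length cs = k + 1 \<and> valid_calls n cs"
proof -
  have "remaining n w j \<noteq> {} \<and> remaining n w j \<subseteq> {1..n}" if "j \<le> k" for j
    using remaining_nonempty[OF assms(1), of j] that assms(2) by auto
  then have "valid_calls n (map (\<lambda>j. (MaximumProtocol, remaining n w j)) [0..<k + 1])"
    unfolding valid_calls_def by auto
  then show ?thesis unfolding filter_reset_def Let_def by (intro exI conjI) auto
qed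

text \<open>The factor two holds for the gap increased by one because the new midpoint is passed strictly.\<close>

lemma step_cases [consumes 5]:
  assumes inj: "inj_on w {1..n}" and k: "1 \<le> k" "k < n"
    and ok: "state_ok n k w0 s" and gap: "Tminus s \<le> Tplus s"
  obtains
    (quiet) "step n k w s = (s, [], 0)"
  | (halve) s' cs where "step n k w s = (s', cs, 1)" "valid_calls n cs" "length cs \<le> 3"
      "tops s' = tops s" "Tminus s' \<le> Tplus s'"
      "2 * (Tplus s' - Tminus s' + 1) \<le> Tplus s - Tminus s + 1"
      "Tplus s' \<in> insert (Tplus s) (w ` tops s)"
      "Tminus s' \<in> insert (Tminus s) (w ` ({1..n} - tops s))"
  | (reset) cs a b where "step n k w s = (fst (filter_reset n k w), cs, 1)" "valid_calls n cs"
      "length cs \<le> k + 4" "a < b"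
      "a \<in> insert (Tplus s) (w ` tops s)"
      "b \<in> insert (Tminus s) (w ` ({1..n} - tops s))"
proof -
  define A where "A = violating w s (tops s)"
  define rest where "rest = {1..n} - tops s"
  define B where "B = violating w s rest"
  have top: "tops s \<subseteq> {1..n}" "card (tops s) = k"
    and fil: "filters s = midpoint_filters (tops s) (Tplus s) (Tminus s)"
    using ok unfolding state_ok_def by auto
  have ft: "finite (tops s)" using top finite_subset by blast
  have fr: "finite rest" and rsub: "rest \<subseteq> {1..n}" unfolding rest_def by auto
  have tne: "tops s \<noteq> {}" using top k by auto
  have "card rest = n - k" unfolding rest_def using card_Diff_subset[OF ft top(1)] top by simp
  then have rne: "rest \<noteq> {}" using k by auto
  have Asub: "A \<subseteq> tops s" and Bsub: "B \<subseteq> rest" unfolding A_def B_def violating_def by auto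
  have fA: "finite A" and fB: "finite B" using Asub Bsub ft fr finite_subset by blast+
  have A: "2 * w i < Tplus s + Tminus s" if "i \<in> A" for i
    using that unfolding A_def violating_def fil in_midpoint_filters by auto
  have B: "Tplus s + Tminus s < 2 * w i" if "i \<in> B" for i
    using that unfolding B_def rest_def violating_def fil in_midpoint_filters by auto
  define mn where "mn = (if A = {} then None else Some (Min (w ` A)))"
  define mx where "mx = (if B = {} then None else Some (Max (w ` B)))"
  define cs0 where "cs0 = (if A = {} then [] else [(MinimumProtocol, A)]) @
               (if B = {} then [] else [(MaximumProtocol, B)])"
  have step: "step n k w s = (if A = {} \<and> B = {} then (s, [], 0)
     else (let (s', cs', m) = violation_handler n k w s mn mx in (s', cs0 @ cs', m)))"
    unfolding step_def Let_def A_def B_def rest_def mn_def mx_def cs0_def by simp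
  show thesis
  proof (cases "A = {} \<and> B = {}")
    case True
    then show thesis using step quiet by simp
  next
    case False
    \<comment> \<open>If \<open>B\<close> is empty, then \<open>A\<close> is not, so its minimum is
      meaningful. Otherwise the handler recomputes the minimum over all top nodes, even if violating
      ones have already reported.\<close>
    define mn' where "mn' = (if B = {} then Min (w ` A) else Min (w ` tops s))"
    define mx' where "mx' = (if B = {} then Max (w ` rest) else Max (w ` B))"
    define c where "c = (if B = {} then (MaximumProtocol, rest) else (MinimumProtocol, tops s))"
    define a where "a = min (Tplus s) mn'"
    define b where "b = max (Tminus s) mx'"
    have vh: "violation_handler n k w s mn mx =
      (if a < b then (let (s', cs, m) = filter_reset n k w in (s', c # cs, m))
       else (s\<lparr>filters := midpoint_filters (tops s) a b, Tplus := a, Tminus := b\<rparr>, [c], 1))"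
      using False unfolding violation_handler_def mn_def mx_def a_def b_def mn'_def mx'_def c_def rest_def
      by (cases "B = {}") (simp_all add: Let_def)
    have len: "length cs0 \<le> 2" unfolding cs0_def by simp
    have val: "valid_calls n (cs0 @ [c])"
      unfolding valid_calls_def cs0_def c_def using Asub Bsub top rsub rne tne by auto
    have "mn' \<in> w ` tops s"
    proof (cases "B = {}")
      case True
      then have "mn' \<in> w ` A" unfolding mn'_def using False fA by (auto intro!: Min_in)
      then show ?thesis using Asub by blast
    next
      case False
      then show ?thesis unfolding mn'_def using ft tne by (auto intro!: Min_in)
    qed
    then have a: "a \<in> insert (Tplus s) (w ` tops s)" unfolding a_def min_def by simp
    have "mx' \<in> w ` rest"
    proof (cases "B = {}")
      case True
      then show ?thesis unfolding mx'_def using fr rne by (auto intro!: Max_in)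
    next
      case False
      then have "mx' \<in> w ` B" unfolding mx'_def using fB by (auto intro!: Max_in)
      then show ?thesis using Bsub by blast
    qed
    then have b: "b \<in> insert (Tminus s) (w ` ({1..n} - tops s))"
      unfolding b_def max_def rest_def by simp
    show thesis
    proof (cases "a < b")
      case True
      obtain s' cs where fr: "filter_reset n k w = (s', cs, 1)" "length cs = k + 1" "valid_calls n cs"
        using filter_reset_calls[OF inj k(2)] by blast
      have "step n k w s = (fst (filter_reset n k w), cs0 @ c # cs, 1)"
        unfolding step vh using False True fr(1) by auto
      moreover have "valid_calls n (cs0 @ c # cs)" using val fr(3) unfolding valid_calls_def by auto
      ultimately show thesis using reset[OF _ _ _ True a b] len fr(2) by simp
    next
      case nlt: False
      \<comment> \<open>A violating node lies strictly beyond the midpoint; for integers this gains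
        the one that makes the gap plus one halve exactly.\<close>
      have "2 * a + 1 \<le> Tplus s + Tminus s \<or> Tplus s + Tminus s + 1 \<le> 2 * b"
      proof (cases "B = {}")
        case True
        then have "mn' \<in> w ` A" unfolding mn'_def using False fA by (auto intro!: Min_in)
        then show ?thesis using A unfolding a_def by fastforce
      next
        case False
        then have "mx' \<in> w ` B" unfolding mx'_def using fB by (auto intro!: Max_in)
        then show ?thesis using B unfolding b_def by fastforce
      qed
      moreover have "a \<le> Tplus s" "Tminus s \<le> b" unfolding a_def b_def by auto
      \<comment> \<open>Naming the differences turns the truncated subtractions into linear
        arithmetic.\<close>
      moreover obtain d where "a = b + d" using nlt by (metis le_Suc_ex not_less)
      moreover obtain e where "Tplus s = Tminus s + e" using gap le_Suc_ex by blast
      ultimately have gap': "2 * (a - b + 1) \<le> Tplus s - Tminus s + 1" by auto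
      show thesis
        by (rule halve[of "s\<lparr>filters := midpoint_filters (tops s) a b, Tplus := a, Tminus := b\<rparr>" "cs0 @ [c]"])
          (use False nlt vh step val len a b gap' in \<open>simp_all\<close>)
    qed
  qed
qed

section \<open>The optimal offline algorithm\<close>

lemma offline_filters_const:
  assumes alg: "offline_filter_alg n k v T F ms" and "t0 \<le> t" "t1 \<le> T" "t \<le> t1"
    and silent: "\<And>t. t0 < t \<Longrightarrow> t \<le> t1 \<Longrightarrow> ms t = []" and i: "i \<in> {1..n}"
  shows "F t i = F t0 i"
  using \<open>t0 \<le> t\<close> \<open>t \<le> t1\<close>
proof (induction t rule: dec_induct)
  case (step t)
  have "Suc t \<le> T" using step.prems \<open>t1 \<le> T\<close> by simp
  then have "F (Suc t) i \<noteq> F t i \<longrightarrow> reaches (ms (Suc t)) i"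
    using alg i unfolding offline_filter_alg_def by fastforce
  then have "F (Suc t) i = F t i" using silent[of "Suc t"] step unfolding reaches_def by auto
  then show ?case using step by simp
qed simp

text \<open>If OPT is silent, its filters from time \<open>t0\<close> stay in force, so they admit
  \<open>v p i\<close> and \<open>v q j\<close> simultaneously, although \<open>p\<close> and
  \<open>q\<close> may differ. A mixed vector with these two values then ranks \<open>j\<close>
  above \<open>i\<close> inside the filters. Leaving out \<open>t0\<close> itself makes the message
  windows of successive phases disjoint.\<close>

lemma opt_sends_in_phase:
  assumes dist: "distinct_streams n v" and alg: "offline_filter_alg n k v T F ms" and "t1 \<le> T"
    and p: "t0 \<le> p" "p \<le> t1" and q: "t0 \<le> q" "q \<le> t1"
    and i: "i \<in> topk n k (v t0)" and j: "j \<in> {1..n} - topk n k (v t0)"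
    and less: "v p i < v q j"
  shows "1 \<le> (\<Sum>t\<in>{t0<..t1}. length (ms t))"
proof (rule ccontr)
  assume "\<not> ?thesis"
  then have "(\<Sum>t\<in>{t0<..t1}. length (ms t)) = 0" by linarith
  then have silent: "ms t = []" if "t0 < t" "t \<le> t1" for t
    using that by simp
  have inj: "inj_on (v t) {1..n}" for t using dist unfolding distinct_streams_def by simp
  define S where "S = topk n k (v t0)"
  have fs: "is_filter_set n k (v t0) (F t0)"
    using alg p \<open>t1 \<le> T\<close> unfolding offline_filter_alg_def by simp
  have in_F: "in_filter (v t x) (F t0 x)" if "t0 \<le> t" "t \<le> t1" "x \<in> {1..n}" for t x
  proof -
    have "is_filter_set n k (v t) (F t)"
      using alg that \<open>t1 \<le> T\<close> unfolding offline_filter_alg_def by simp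
    then have "in_filter (v t x) (F t x)" using that(3) unfolding is_filter_set_def by blast
    then show ?thesis
      using offline_filters_const[OF alg that(1) \<open>t1 \<le> T\<close> that(2) silent that(3)] by simp
  qed
  have S: "topk n k w = S" if "inj_on w {1..n}" "\<And>x. x \<in> {1..n} \<Longrightarrow> in_filter (w x) (F t0 x)" for w
    using fs that unfolding is_filter_set_def S_def by blast
  have Sp: "topk n k (v p) = S" and Sq: "topk n k (v q) = S"
    using S inj in_F p q by auto
  have iS: "i \<in> S" "i \<in> {1..n}" and jS: "j \<notin> S" "j \<in> {1..n}"
    using i j unfolding S_def topk_def by auto
  have lq: "v q y < v q x" if "x \<in> S" "y \<in> {1..n} - S" for x y
    using topk_less[of x n k "v q" y] Sq that by simp
  have lp: "v p y < v p x" if "x \<in> S" "y \<in> {1..n} - S" for x y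
    using topk_less[of x n k "v p" y] Sp that by simp
  txt \<open>Raising the other top nodes to their values at time \<open>q\<close> and lowering the other non-top
    nodes to their values at time \<open>p\<close> keeps the values pairwise distinct.\<close>
  define w where "w x = (if x \<in> S then if x = i then v p i else v q x
                         else if x = j then v q j else v p x)" for x
  have "inj_on w {1..n}"
  proof (rule inj_onI)
    fix x y assume xy: "x \<in> {1..n}" "y \<in> {1..n}" "w x = w y"
    \<comment> \<open>The other non-top nodes lie below \<open>v p i\<close>, which is below
      \<open>v q j\<close>, which is below the other top nodes. So only nodes of the same group
      could collide, and those take their values from a single time.\<close>
    have hi: "v q j < w x" if "x \<in> S" "x \<noteq> i" for x
      using lq[of x j] that jS unfolding w_def by simp
    have lo: "w x < v p i" if "x \<in> {1..n}" "x \<notin> S" "x \<noteq> j" for x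
      using lp[of i x] that iS unfolding w_def by simp
    have wi: "w i = v p i" and wj: "w j = v q j" using iS jS unfolding w_def by auto
    have mid: "x = i \<or> x = j \<or> (x \<in> S \<and> w x = v q x \<and> v q j < w x)
      \<or> (x \<notin> S \<and> w x = v p x \<and> w x < v p i)" if "x \<in> {1..n}" for x
      using hi[of x] lo[of x] that unfolding w_def by auto
    show "x = y"
      using mid[OF xy(1)] mid[OF xy(2)] xy wi wj less
        inj_onD[OF inj[of p], of x y] inj_onD[OF inj[of q], of x y]
      by (elim disjE conjE) auto
  qed
  moreover have "in_filter (w x) (F t0 x)" if "x \<in> {1..n}" for x
    using in_F[OF p that] in_F[OF q that] unfolding w_def by auto
  ultimately have "topk n k w = S" using S by blast
  then have "w j < w i" using topk_less[of i n k w j] iS jS by simp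
  then show False using less iS jS unfolding w_def by simp
qed

lemma offline_alg_exists:
  assumes "distinct_streams n v"
  shows "offline_filter_alg n k v T (\<lambda>t i. (ereal (real (v t i)), ereal (real (v t i)))) (\<lambda>t. [Broadcast])"
proof -
  have "is_filter_set n k w (\<lambda>i. (ereal (real (w i)), ereal (real (w i))))" for w
    unfolding is_filter_set_def in_filter_def
    by (auto intro!: topk_cong simp: order_antisym)
  then show ?thesis unfolding offline_filter_alg_def reaches_def by auto
qed

lemma OPT_attained:
  assumes "distinct_streams n v"
  obtains F ms where "offline_filter_alg n k v T F ms" "OPT n k v T = (\<Sum>t\<le>T. length (ms t))"
proof -
  let ?X = "{\<Sum>t\<le>T. length (ms t) | F ms. offline_filter_alg n k v T F ms}"
  have "?X \<noteq> {}" using offline_alg_exists[OF assms, of k T] by blast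
  then have "OPT n k v T \<in> ?X" unfolding OPT_def by (rule Inf_nat_def1)
  then show thesis using that by blast
qed

section \<open>Amortization over the phases\<close>

text \<open>A deterministic stand-in for the expected cost of a step: every call is charged the
  bound \<open>B\<close>.\<close>

definition step_cost :: "real \<Rightarrow> outcome \<Rightarrow> real" where
  "step_cost B r = (case r of (s, cs, m) \<Rightarrow> real (length cs) * B + real m)"

lemma state_ok_run:
  assumes "distinct_streams n v" "1 \<le> k" "k < n"
  shows "state_ok n k (v t) (fst (run n k v t))"
  using assms by (induction t) (auto simp: distinct_streams_def state_ok_filter_reset state_ok_step)

text \<open>\<open>N\<close> counts the completed phases; \<open>h\<close> counts the violations in the current phase,
  which started at time \<open>t0\<close>; and \<open>H\<close> bounds the number of violations in any phase.\<close>

definition phase_inv ::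
  "nat \<Rightarrow> nat \<Rightarrow> streams \<Rightarrow> nat \<Rightarrow> (nat \<Rightarrow> message list) \<Rightarrow> real \<Rightarrow> real \<Rightarrow> nat \<Rightarrow> nat \<Rightarrow> nat \<Rightarrow> nat \<Rightarrow> bool"
where
  "phase_inv n k v D ms B H t N h t0 \<longleftrightarrow>
     (let s = fst (run n k v t) in
      t0 \<le> t \<and> tops s = topk n k (v t0) \<and> Tminus s \<le> Tplus s \<and>
      2 ^ h * (Tplus s - Tminus s + 1) \<le> D + 1 \<and>
      (\<exists>p\<in>{t0..t}. Tplus s \<in> v p ` tops s) \<and>
      (\<exists>q\<in>{t0..t}. Tminus s \<in> v q ` ({1..n} - tops s)) \<and>
      N + 1 \<le> (\<Sum>u\<le>t0. length (ms u)) \<and>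
      (\<Sum>u\<le>t. step_cost B (run n k v u))
        \<le> real N * ((real k + 5 + 4 * H) * B) + (real k + 5) * B + 4 * real h * B)"

text \<open>A halving step increments \<open>h\<close>, a reset increments \<open>N\<close> and
  clears \<open>h\<close>. As \<open>1 \<le> B\<close> pays for a broadcast, \<open>4 * B\<close>
  covers a halving (at most three calls) and \<open>(k + 5) * B\<close> a reset (at most
  \<open>k + 4\<close> calls).\<close>

lemma phase_inv_exists:
  assumes dist: "distinct_streams n v" and k: "1 \<le> k" "k < n" and B: "1 \<le> B"
    and alg: "offline_filter_alg n k v T F ms"
    and H: "\<And>h. 2 ^ h \<le> Delta n k v T + 1 \<Longrightarrow> real h \<le> H"
    and "t \<le> T"
  shows "\<exists>N h t0. phase_inv n k v (Delta n k v T) ms B H t N h t0"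
  using \<open>t \<le> T\<close>
proof (induction t)
  case 0
  have inj: "inj_on (v 0) {1..n}" using dist unfolding distinct_streams_def by simp
  note fr = filter_reset_props[OF inj k]
  \<comment> \<open>OPT has to send its initial filters at time \<open>0\<close>; this message is
    the extra one in \<open>N + 1\<close>.\<close>
  have "1 \<in> {1..n}" using k by simp
  then have "reaches (ms 0) 1" using alg unfolding offline_filter_alg_def by blast
  then have "ms 0 \<noteq> []" unfolding reaches_def by auto
  then have "1 \<le> length (ms 0)" by (simp add: Suc_leI)
  moreover obtain s cs where "filter_reset n k (v 0) = (s, cs, 1)" "length cs = k + 1"
    using filter_reset_calls[OF inj k(2)] by blast
  then have "step_cost B (run n k v 0) \<le> (real k + 5) * B"
    using B unfolding step_cost_def by (simp add: algebra_simps)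
  moreover have "tops (fst (run n k v 0)) = topk n k (v 0)" using top_run[OF dist k] .
  ultimately have "phase_inv n k v (Delta n k v T) ms B H 0 0 0 0"
    unfolding phase_inv_def Let_def using fr Delta_upper[of 0 T n k v] by simp
  then show ?case by blast
next
  case (Suc t)
  define s where "s = fst (run n k v t)"
  define w where "w = v (Suc t)"
  define D where "D = Delta n k v T"
  have inj: "inj_on w {1..n}" using dist unfolding distinct_streams_def w_def by simp
  obtain N h t0 where "phase_inv n k v D ms B H t N h t0" using Suc unfolding D_def by auto
  then have t0: "t0 \<le> t" and tops: "tops s = topk n k (v t0)" and gap: "Tminus s \<le> Tplus s"
    and pow: "2 ^ h * (Tplus s - Tminus s + 1) \<le> D + 1"
    and Tp: "\<exists>p\<in>{t0..t}. Tplus s \<in> v p ` tops s"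
    and Tm: "\<exists>q\<in>{t0..t}. Tminus s \<in> v q ` ({1..n} - tops s)"
    and N: "N + 1 \<le> (\<Sum>u\<le>t0. length (ms u))"
    and cost: "(\<Sum>u\<le>t. step_cost B (run n k v u))
        \<le> real N * ((real k + 5 + 4 * H) * B) + (real k + 5) * B + 4 * real h * B"
    unfolding phase_inv_def Let_def s_def by blast+
  \<comment> \<open>An updated bound is either the old one, with its old witness, or a value held
    right now.\<close>
  have Tp': "\<exists>p\<in>{t0..Suc t}. a \<in> v p ` tops s" if "a \<in> insert (Tplus s) (w ` tops s)" for a
  proof (cases "a = Tplus s")
    case True
    then show ?thesis using Tp by fastforce
  next
    case False
    then show ?thesis using that t0 unfolding w_def by (intro bexI[of _ "Suc t"]) auto
  qed
  have Tm': "\<exists>q\<in>{t0..Suc t}. b \<in> v q ` ({1..n} - tops s)"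
    if "b \<in> insert (Tminus s) (w ` ({1..n} - tops s))" for b
  proof (cases "b = Tminus s")
    case True
    then show ?thesis using Tm by fastforce
  next
    case False
    then show ?thesis using that t0 unfolding w_def by (intro bexI[of _ "Suc t"]) auto
  qed
  have run: "run n k v (Suc t) = step n k w s" unfolding s_def w_def by simp
  have ok: "state_ok n k (v t) s" unfolding s_def by (rule state_ok_run[OF dist k])
  show ?case
    using inj k ok gap
  proof (cases rule: step_cases)
    case quiet
    have "phase_inv n k v D ms B H (Suc t) N h t0"
      unfolding phase_inv_def Let_def sum.atMost_Suc run quiet fst_conv
      using t0 tops gap pow Tp'[of "Tplus s"] Tm'[of "Tminus s"] N cost by (simp add: step_cost_def)
    then show ?thesis unfolding D_def by blast
  next
    case (halve s' cs)
    have "2 ^ Suc h * (Tplus s' - Tminus s' + 1) \<le> 2 ^ h * (Tplus s - Tminus s + 1)"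
      using mult_le_mono2[OF halve(6), of "2 ^ h"] by (simp add: mult_ac)
    then have pow': "2 ^ Suc h * (Tplus s' - Tminus s' + 1) \<le> D + 1" using pow by (rule le_trans)
    have "real (length cs) * B \<le> 3 * B" using halve(3) B by (intro mult_right_mono) auto
    moreover have "step_cost B (s', cs, 1) = real (length cs) * B + 1" by (simp add: step_cost_def)
    ultimately have "step_cost B (s', cs, 1) \<le> 4 * B" using B by linarith
    then have "phase_inv n k v D ms B H (Suc t) N (Suc h) t0"
      unfolding phase_inv_def Let_def sum.atMost_Suc run halve(1) fst_conv halve(4)
      using t0 tops halve(5) pow' Tp'[OF halve(7)] Tm'[OF halve(8)] N cost
      by (simp add: algebra_simps)
    then show ?thesis unfolding D_def by blast
  next
    case (reset cs a b)
    obtain p i where p: "p \<in> {t0..Suc t}" "i \<in> tops s" "a = v p i" using Tp'[OF reset(5)] by blast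
    obtain q j where q: "q \<in> {t0..Suc t}" "j \<in> {1..n} - tops s" "b = v q j"
      using Tm'[OF reset(6)] by blast
    have "1 \<le> (\<Sum>u\<in>{t0<..Suc t}. length (ms u))"
      by (rule opt_sends_in_phase[OF dist alg, of "Suc t" t0 p q i j])
        (use p q tops reset(4) Suc.prems in auto)
    moreover have "(\<Sum>u\<le>Suc t. length (ms u)) =
        (\<Sum>u\<le>t0. length (ms u)) + (\<Sum>u\<in>{t0<..Suc t}. length (ms u))"
    proof -
      have "{..Suc t} = {..t0} \<union> {t0<..Suc t}" using t0 by auto
      moreover have "{..t0} \<inter> {t0<..Suc t} = {}" by auto
      ultimately show ?thesis by (metis finite_atMost finite_greaterThanAtMost sum.union_disjoint)
    qed
    ultimately have N': "N + 1 + 1 \<le> (\<Sum>u\<le>Suc t. length (ms u))" using N by simp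
    have "2 ^ h \<le> D + 1" using pow by (metis le_add2 le_trans mult.right_neutral mult_le_mono2)
    then have "real h \<le> H" using H unfolding D_def by blast
    then have hB: "real h * B \<le> H * B" using B by (intro mult_right_mono) auto
    have "real (length cs) * B \<le> (real k + 4) * B"
      using reset(3) B by (intro mult_right_mono) auto
    then have c: "step_cost B (fst (filter_reset n k w), cs, 1) \<le> (real k + 5) * B"
      using B unfolding step_cost_def by (simp add: algebra_simps)
    \<comment> \<open>The opening reset and the \<open>h\<close> halvings of the closed phase move
      into the term for \<open>N + 1\<close>; the present reset takes over the separate summand
      \<open>(k + 5) * B\<close>.\<close>
    have cost': "(\<Sum>u\<le>Suc t. step_cost B (run n k v u))
        \<le> real (N + 1) * ((real k + 5 + 4 * H) * B) + (real k + 5) * B + 4 * real 0 * B"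
      unfolding sum.atMost_Suc run reset(1) using cost c hB by (simp add: algebra_simps)
    note fr = filter_reset_props[OF inj k]
    have "tops (fst (filter_reset n k w)) = topk n k w"
      using top_run[OF dist k, of "Suc t"] unfolding run reset(1) by (simp only: w_def fst_conv)
    then have "phase_inv n k v D ms B H (Suc t) (N + 1) 0 (Suc t)"
      unfolding phase_inv_def Let_def run reset(1) fst_conv
      using fr N' cost' Delta_upper[OF Suc.prems, of n k v]
      by (simp add: D_def w_def del: run.simps sum.atMost_Suc)
    then show ?thesis unfolding D_def by blast
  qed
qed

section \<open>Expected number of messages\<close>

lemma valid_calls_run:
  assumes dist: "distinct_streams n v" and k: "1 \<le> k" "k < n"
    and r: "run n k v t = (s, cs, m)"
  shows "valid_calls n cs \<and> Tminus s \<le> Tplus s"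
  using r
proof (induction t arbitrary: s cs m)
  case 0
  have inj: "inj_on (v 0) {1..n}" using dist unfolding distinct_streams_def by simp
  then show ?case using filter_reset_props(1)[OF inj k] filter_reset_calls[OF inj k(2)] 0 by auto
next
  case (Suc t)
  have inj: "inj_on (v (Suc t)) {1..n}" using dist unfolding distinct_streams_def by simp
  obtain s0 cs0 m0 where r: "run n k v t = (s0, cs0, m0)" using prod_cases3 by blast
  \<comment> \<open>\<open>step_cases\<close> requires this inequality, so the induction carries it
    along with validity.\<close>
  have gap: "Tminus s0 \<le> Tplus s0" using Suc.IH[OF r] by simp
  have ok: "state_ok n k (v t) s0" using state_ok_run[OF dist k, of t] r by simp
  have st: "step n k (v (Suc t)) s0 = (s, cs, m)" using Suc.prems r by simp
  show ?case
    by (cases rule: step_cases[OF inj k ok gap])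
      (use st gap filter_reset_props(1)[OF inj k] in \<open>auto simp: valid_calls_def\<close>)
qed

text \<open>Which calls are made depends on the streams only, not on the random usage, so linearity
  of expectation suffices.\<close>

lemma expected_messages_le:
  assumes dist: "distinct_streams n v" and k: "1 \<le> k" "k < n" and P: "protocol_bound n (P v) B"
  shows "expected_messages n k P v T \<le> (\<Sum>t\<le>T. step_cost B (run n k v t))"
proof -
  interpret prob_space "P v" using P unfolding protocol_bound_def by simp
  define cs where "cs t = fst (snd (run n k v t))" for t
  define m where "m t = snd (snd (run n k v t))" for t
  have X: "integrable (P v) (\<lambda>X. real (X (t, j, cs t ! j))) \<and>
      (\<integral>X. real (X (t, j, cs t ! j)) \<partial>P v) \<le> B" if "j < length (cs t)" for t j
  proof -
    obtain p S where pS: "cs t ! j = (p, S)" by fastforce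
    have "valid_calls n (cs t)"
      using valid_calls_run[OF dist k, of t] unfolding cs_def by (metis prod.collapse)
    then have "S \<noteq> {} \<and> S \<subseteq> {1..n}"
      using nth_mem[OF that] pS unfolding valid_calls_def by fastforce
    then show ?thesis using P pS unfolding protocol_bound_def by simp
  qed
  have "expected_messages n k P v T =
      (\<integral>X. (\<Sum>t\<le>T. (\<Sum>j<length (cs t). real (X (t, j, cs t ! j))) + real (m t)) \<partial>P v)"
    unfolding expected_messages_def messages_def cs_def m_def by (simp add: case_prod_beta)
  also have "\<dots> = (\<Sum>t\<le>T. (\<Sum>j<length (cs t). (\<integral>X. real (X (t, j, cs t ! j)) \<partial>P v)) + real (m t))"
  proof -
    have int: "integrable (P v) (\<lambda>X. \<Sum>j<length (cs t). real (X (t, j, cs t ! j)))" for t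
      using X by (intro Bochner_Integration.integrable_sum) auto
    have "(\<integral>X. (\<Sum>j<length (cs t). real (X (t, j, cs t ! j))) + real (m t) \<partial>P v) =
        (\<Sum>j<length (cs t). (\<integral>X. real (X (t, j, cs t ! j)) \<partial>P v)) + real (m t)" for t
      using X by (subst Bochner_Integration.integral_add[OF int], simp,
          subst Bochner_Integration.integral_sum) (auto simp: prob_space)
    then show ?thesis
      using int by (subst Bochner_Integration.integral_sum) auto
  qed
  also have "\<dots> \<le> (\<Sum>t\<le>T. (\<Sum>j<length (cs t). B) + real (m t))"
    using X by (intro sum_mono add_right_mono) auto
  also have "\<dots> = (\<Sum>t\<le>T. step_cost B (run n k v t))"
    unfolding step_cost_def cs_def m_def by (simp add: case_prod_beta)
  finally show ?thesis .
qed

section \<open>Logarithmic bound and competitive ratio\<close>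

lemma Delta_pos:
  assumes "distinct_streams n v" "1 \<le> k" "k < n"
  shows "1 \<le> Delta n k v T"
proof -
  have inj: "inj_on (v 0) {1..n}" using assms(1) unfolding distinct_streams_def by simp
  show ?thesis
    using filter_reset_props(1,2)[OF inj assms(2,3)] Delta_upper[of 0 T n k v] by linarith
qed

text \<open>For \<open>D\<close> at least one, \<open>D + 1\<close> is at most \<open>2 * D\<close>,
  whose binary logarithm is \<open>1 + log 2 D\<close>.\<close>

lemma halvings_le_log:
  assumes "2 ^ h \<le> D + 1" "1 \<le> (D::nat)"
  shows "real h \<le> 1 + log 2 (real D)"
proof -
  have "(2::nat) ^ h \<le> 2 * D" using assms by linarith
  then have "(2::real) ^ h \<le> 2 * real D" by (metis of_nat_le_iff of_nat_mult of_nat_numeral of_nat_power)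
  then have "real h \<le> log 2 (2 * real D)" using assms(2) by (intro le_log_of_power) auto
  also have "\<dots> = 1 + log 2 (real D)" using assms(2) by (simp add: log_mult)
  finally show ?thesis .
qed

theorem theorem1:
  shows "\<exists>C>0. \<forall>(n::nat) (k::nat) (M :: nat \<Rightarrow> real) (P :: streams \<Rightarrow> usage measure).
    1 \<le> k \<longrightarrow> k < n \<longrightarrow> 1 \<le> M n \<longrightarrow>
    (\<forall>v. distinct_streams n v \<longrightarrow> protocol_bound n (P v) (M n)) \<longrightarrow>
    competitive n k (expected_messages n k P)
      (\<lambda>v T. C * ((log 2 (real (Delta n k v T)) + real k) * M n))"
proof (intro exI[of _ "10::real"] conjI allI impI)
  fix n k :: nat and M :: "nat \<Rightarrow> real" and P :: "streams \<Rightarrow> usage measure"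
  assume k: "1 \<le> k" "k < n" and B: "1 \<le> M n"
    and P: "\<forall>v. distinct_streams n v \<longrightarrow> protocol_bound n (P v) (M n)"
  show "competitive n k (expected_messages n k P)
      (\<lambda>v T. 10 * ((log 2 (real (Delta n k v T)) + real k) * M n))"
    unfolding competitive_def
  proof (intro allI impI)
    fix v T assume dist: "distinct_streams n v"
    define L where "L = log 2 (real (Delta n k v T))"
    have D: "1 \<le> Delta n k v T" by (rule Delta_pos[OF dist k])
    then have L: "0 \<le> L" unfolding L_def by simp
    obtain F ms where alg: "offline_filter_alg n k v T F ms"
      and opt: "OPT n k v T = (\<Sum>t\<le>T. length (ms t))" using OPT_attained[OF dist] by blast
    have H: "real h \<le> 1 + L" if "2 ^ h \<le> Delta n k v T + 1" for h
      using halvings_le_log[OF that D] unfolding L_def .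
    obtain N h t0 where inv: "phase_inv n k v (Delta n k v T) ms (M n) (1 + L) T N h t0"
      using phase_inv_exists[OF dist k B alg H order_refl] by blast
    define s where "s = fst (run n k v T)"
    have t0: "t0 \<le> T" and pow: "2 ^ h * (Tplus s - Tminus s + 1) \<le> Delta n k v T + 1"
      and N: "N + 1 \<le> (\<Sum>u\<le>t0. length (ms u))"
      and cost: "(\<Sum>u\<le>T. step_cost (M n) (run n k v u))
        \<le> real N * ((real k + 5 + 4 * (1 + L)) * M n) + (real k + 5) * M n + 4 * real h * M n"
      using inv unfolding phase_inv_def Let_def s_def by blast+
    have "2 ^ h \<le> Delta n k v T + 1"
      using pow by (metis le_add2 le_trans mult.right_neutral mult_le_mono2)
    \<comment> \<open>The unfinished phase is charged like a completed one, giving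
      \<open>N + 1\<close> phases, as many as the messages guaranteed for OPT.\<close>
    then have "real h * M n \<le> (1 + L) * M n" using B H by (intro mult_right_mono) auto
    then have "(\<Sum>u\<le>T. step_cost (M n) (run n k v u))
        \<le> real (N + 1) * ((real k + 9 + 4 * L) * M n)"
      using cost by (simp add: algebra_simps)
    \<comment> \<open>The constant 10 arises here: \<open>k + 9\<close> is at most
      \<open>10 * k\<close> because \<open>1 \<le> k\<close>, and \<open>4 * L\<close> is at most
      \<open>10 * L\<close> because \<open>0 \<le> L\<close>.\<close>
    also have "\<dots> \<le> real (N + 1) * (10 * (L + real k) * M n)"
      using k L B by (intro mult_left_mono mult_right_mono) auto
    also have "\<dots> \<le> real (OPT n k v T) * (10 * (L + real k) * M n)"
    proof (intro mult_right_mono)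
      have "(\<Sum>u\<le>t0. length (ms u)) \<le> (\<Sum>u\<le>T. length (ms u))"
        using t0 by (intro sum_mono2) auto
      then show "real (N + 1) \<le> real (OPT n k v T)" using N opt by linarith
    qed (use L B in auto)
    finally show "expected_messages n k P v T
        \<le> 10 * ((log 2 (real (Delta n k v T)) + real k) * M n) * real (OPT n k v T)"
      using expected_messages_le[OF dist k, of P "M n" T] P dist unfolding L_def
      by (simp add: mult_ac)
  qed
qed simp

end
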